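(* Consider the optimal control problem $\min j(y(T))$ subject to $\dot y=f(y,u)+g(y,u)$, $y(0)=y^0$, and assume $\tilde\omega_i\neq 0$ and $\omega_i\neq 0$ for $i=1,\dots,s$. (i) The equations (S) and (A) of the context are the discrete state and adjoint equations of the optimality system of the discrete problem $\min j(y_N)$ subject to (S). That is: let $(y_n)_{n=0}^N$, $(Y_n^{(i)})$ satisfy (S) for given controls $u_n^i$, and let $p_0,\dots,p_N\in\mathbb{R}^K$. There exist $\zeta_n^{(i)}\in\mathbb{R}^K$ ($i=1,\dots,s$, $n=0,\dots,N-1$) such that the Lagrangian $\mathcal L$ of the discrete problem is stationary with respect to all the variables $y_n$ and $Y_n^{(i)}$ at this point if and only if $p_N=j'(y_N)$ and there exist $\tilde P_n^{(i)},P_n^{(i)}\in\mathbb{R}^K$ such that (A) holds for $n=0,\dots,N-1$. (ii) The equations (S) and (A) are a Runge--Kutta discretization (in the sense defined in the context) of the continuous state equation $\dot y=f(y,u)+g(y,u)$, $y(0)=y^0$, and the continuous adjoint equation $\dot p=-f_y(y,u)^Tp-g_y(y,u)^Tp$, $p(T)=j'(y(T))$.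
   Context: Let $f,g:\mathbb{R}^K\times\mathbb{R}^m\to\mathbb{R}^K$ and $j:\mathbb{R}^K\to\mathbb{R}$ be sufficiently smooth; $f_y,g_y$ denote Jacobians with respect to $y$ and $j'$ the gradient of $j$. Let $h=T/N>0$, $s\ge 1$, and let real Runge--Kutta coefficients $\tilde A=(\tilde a_{ij})$, $A=(a_{ij})$ ($s\times s$ matrices) and weights $\tilde\omega_i,\omega_i$ be given ($i=1,\dots,s$). (S), the discrete state equations: for $n=0,\dots,N-1$, $i=1,\dots,s$, $$Y_n^{(i)}=y_n+h\sum_{j=1}^s\tilde a_{ij}f(Y_n^{(j)},u_n^j)+h\sum_{j=1}^s a_{ij}g(Y_n^{(j)},u_n^j),$$ $$y_{n+1}=y_n+h\sum_{i=1}^s\tilde\omega_if(Y_n^{(i)},u_n^i)+h\sum_{i=1}^s\omega_ig(Y_n^{(i)},u_n^i),\qquad y_0=y^0.$$ (A), the discrete adjoint equations: $$\tilde P_n^{(i)}=p_n-h\sum_{j=1}^s\tilde\alpha_{ij}f_y(Y_n^{(j)},u_n^j)^T\tilde P_n^{(j)}-h\sum_{j=1}^s\alpha_{ij}g_y(Y_n^{(j)},u_n^j)^TP_n^{(j)},$$ $$P_n^{(i)}=p_n-h\sum_{j=1}^s\tilde\beta_{ij}f_y(Y_n^{(j)},u_n^j)^T\tilde P_n^{(j)}-h\sum_{j=1}^s\beta_{ij}g_y(Y_n^{(j)},u_n^j)^TP_n^{(j)},$$ $$p_{n+1}=p_n-h\sum_{i=1}^s\tilde\omega_if_y(Y_n^{(i)},u_n^i)^T\tilde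 P_n^{(i)}-h\sum_{i=1}^s\omega_ig_y(Y_n^{(i)},u_n^i)^TP_n^{(i)},$$ where $$\tilde\alpha_{ij}=\tilde\omega_j-\frac{\tilde\omega_j}{\tilde\omega_i}\tilde a_{ji},\quad \alpha_{ij}=\omega_j-\frac{\omega_j}{\tilde\omega_i}\tilde a_{ji},\quad \tilde\beta_{ij}=\tilde\omega_j-\frac{\tilde\omega_j}{\omega_i}a_{ji},\quad \beta_{ij}=\omega_j-\frac{\omega_j}{\omega_i}a_{ji}.$$ The Lagrangian of the discrete problem, with multipliers $p_n$ and $\zeta_n^{(i)}$, is $$\mathcal L=j(y_N)-p_0^T(y_0-y^0)+\sum_{n=0}^{N-1}\Big[p_{n+1}^T\Big(-y_{n+1}+y_n+h\sum_i\tilde\omega_if(Y_n^{(i)},u_n^i)+h\sum_i\omega_ig(Y_n^{(i)},u_n^i)\Big)$$ $$\qquad+\sum_{i=1}^s(\zeta_n^{(i)})^T\Big(-Y_n^{(i)}+y_n+h\sum_j\tilde a_{ij}f(Y_n^{(j)},u_n^j)+h\sum_ja_{ij}g(Y_n^{(j)},u_n^j)\Big)\Big].$$ Meaning of "Runge--Kutta discretization" in (ii). Consider the extended system $$\dot y=f(y,u)+g(y,u),\qquad \dot{\tilde p}=-f_y(y,u)^T\tilde p-g_y(y,u)^Tp,\qquad \dot p=-f_y(y,u)^T\tilde p-g_y(y,u)^Tp.$$ Then (S), (A) are called a Runge--Kutta discretization of the state and adjoint equations if: (1) after adding the update $$\tilde p_{n+1}=\tilde p_n-h\sum_{i}\tilde\omega_if_y(Y_n^{(i)},u_n^i)^T\tilde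 P_n^{(i)}-h\sum_i\omega_ig_y(Y_n^{(i)},u_n^i)^TP_n^{(i)}$$ with $\tilde p_N=p_N$ (so that $\tilde p_n=p_n$ for all $n$), the equations (S), (A) are exactly an $s$-stage additive Runge--Kutta method applied to the extended system, with stage values $(Y_n^{(i)},\tilde P_n^{(i)},P_n^{(i)})$ for $(y,\tilde p,p)$, where each of the three components and each of the two terms on the right-hand side (the $f$-term and the $g$-term) may have its own coefficient matrix, and the weights are $\tilde\omega$ for the $f$-terms and $\omega$ for the $g$-terms; and (2) the extended system with $y(0)=y^0$ and $\tilde p(T)=p(T)=j'(y(T))$ is equivalent to the state and adjoint equations, in the sense that its solutions satisfy $\tilde p\equiv p$ and $(y,p)$ solves the state and adjoint equations, and conversely. *)

theory Defs
  imports "HOL-Analysis.Analysis"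
begin

text \<open>The phrase ``sufficiently smooth'' is read as: once continuously differentiable.\<close>

definition C1 :: "('a::real_normed_vector \<Rightarrow> 'b::real_normed_vector) \<Rightarrow> bool" where
  "C1 F \<longleftrightarrow>
     (\<exists>F' :: 'a \<Rightarrow> 'a \<Rightarrow>\<^sub>L 'b. (\<forall>x. (F has_derivative blinfun_apply (F' x)) (at x)) \<and> continuous_on UNIV F')"

definition jac_y ::
  "((real^'k) \<times> (real^'m) \<Rightarrow> real^'k) \<Rightarrow> (real^'k) \<times> (real^'m) \<Rightarrow> real^'k^'k" where
  "jac_y f = (\<lambda>(y, u). jacobian (\<lambda>z. f (z, u)) (at y))"

definition gradient :: "('a::real_inner \<Rightarrow> real) \<Rightarrow> 'a \<Rightarrow> 'a" where
  "gradient j y = (THE D. GDERIV j y :> D)"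


section \<open>The discrete problem\<close>

text \<open>
  The stages are indexed by a finite type \<open>'s\<close>, the time steps by natural numbers: \<open>ys n\<close> is
  $y_n$ and \<open>Y n i\<close> is $Y_n^{(i)}$. Only the values \<open>ys n\<close> with \<open>n \<le> N\<close> and \<open>Y n i\<close> with
  \<open>n < N\<close> are ever constrained. The matrix \<open>At\<close> and the weights \<open>wt\<close> are $\tilde A$ and
  $\tilde\omega$; likewise \<open>Pt\<close> is $\tilde P$.
\<close>

definition state_eqs ::
  "real^'s^'s \<Rightarrow> real^'s^'s \<Rightarrow> real^'s \<Rightarrow> real^'s \<Rightarrow>
   ((real^'k) \<times> (real^'m) \<Rightarrow> real^'k) \<Rightarrow> ((real^'k) \<times> (real^'m) \<Rightarrow> real^'k) \<Rightarrow>
   real \<Rightarrow> nat \<Rightarrow> real^'k \<Rightarrow> (nat \<Rightarrow> 's::finite \<Rightarrow> real^'m) \<Rightarrow>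
   (nat \<Rightarrow> real^'k) \<Rightarrow> (nat \<Rightarrow> 's \<Rightarrow> real^'k) \<Rightarrow> bool" where
  "state_eqs At A wt w f g h N y0 u ys Y \<longleftrightarrow>
     ys 0 = y0 \<and>
     (\<forall>n<N.
        (\<forall>i. Y n i = ys n + h *\<^sub>R (\<Sum>j\<in>UNIV. At$i$j *\<^sub>R f (Y n j, u n j))
                          + h *\<^sub>R (\<Sum>j\<in>UNIV. A$i$j *\<^sub>R g (Y n j, u n j))) \<and>
        ys (Suc n) = ys n + h *\<^sub>R (\<Sum>i\<in>UNIV. wt$i *\<^sub>R f (Y n i, u n i))
                          + h *\<^sub>R (\<Sum>i\<in>UNIV. w$i *\<^sub>R g (Y n i, u n i)))"

text \<open>
  The adjoint coefficients $\tilde\alpha$, $\alpha$, $\tilde\beta$, $\beta$ are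
  \<open>adj_coef wt wt At\<close>, \<open>adj_coef w wt At\<close>, \<open>adj_coef wt w A\<close>, \<open>adj_coef w w A\<close>.
\<close>

definition adj_coef :: "real^'s \<Rightarrow> real^'s \<Rightarrow> real^'s^'s \<Rightarrow> real^'s^'s" where
  "adj_coef v d B = (\<chi> i j. v$j - v$j / d$i * B$j$i)"

definition adjoint_eqs ::
  "real^'s^'s \<Rightarrow> real^'s^'s \<Rightarrow> real^'s \<Rightarrow> real^'s \<Rightarrow>
   ((real^'k) \<times> (real^'m) \<Rightarrow> real^'k) \<Rightarrow> ((real^'k) \<times> (real^'m) \<Rightarrow> real^'k) \<Rightarrow>
   real \<Rightarrow> nat \<Rightarrow> (nat \<Rightarrow> 's::finite \<Rightarrow> real^'m) \<Rightarrow> (nat \<Rightarrow> 's \<Rightarrow> real^'k) \<Rightarrow>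
   (nat \<Rightarrow> real^'k) \<Rightarrow> (nat \<Rightarrow> 's \<Rightarrow> real^'k) \<Rightarrow> (nat \<Rightarrow> 's \<Rightarrow> real^'k) \<Rightarrow> bool" where
  "adjoint_eqs At A wt w f g h N u Y p Pt P \<longleftrightarrow>
     (\<forall>n<N.
        (\<forall>i. Pt n i = p n
           - h *\<^sub>R (\<Sum>j\<in>UNIV. adj_coef wt wt At $i$j *\<^sub>R (transpose (jac_y f (Y n j, u n j)) *v Pt n j))
           - h *\<^sub>R (\<Sum>j\<in>UNIV. adj_coef w wt At $i$j *\<^sub>R (transpose (jac_y g (Y n j, u n j)) *v P n j))) \<and>
        (\<forall>i. P n i = p n
           - h *\<^sub>R (\<Sum>j\<in>UNIV. adj_coef wt w A $i$j *\<^sub>R (transpose (jac_y f (Y n j, u n j)) *v Pt n j))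
           - h *\<^sub>R (\<Sum>j\<in>UNIV. adj_coef w w A $i$j *\<^sub>R (transpose (jac_y g (Y n j, u n j)) *v P n j))) \<and>
        p (Suc n) = p n
           - h *\<^sub>R (\<Sum>i\<in>UNIV. wt$i *\<^sub>R (transpose (jac_y f (Y n i, u n i)) *v Pt n i))
           - h *\<^sub>R (\<Sum>i\<in>UNIV. w$i *\<^sub>R (transpose (jac_y g (Y n i, u n i)) *v P n i)))"

definition lagrangian ::
  "real^'s^'s \<Rightarrow> real^'s^'s \<Rightarrow> real^'s \<Rightarrow> real^'s \<Rightarrow>
   ((real^'k) \<times> (real^'m) \<Rightarrow> real^'k) \<Rightarrow> ((real^'k) \<times> (real^'m) \<Rightarrow> real^'k) \<Rightarrow>
   (real^'k \<Rightarrow> real) \<Rightarrow> real \<Rightarrow> nat \<Rightarrow> real^'k \<Rightarrow> (nat \<Rightarrow> 's::finite \<Rightarrow> real^'m) \<Rightarrow>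
   (nat \<Rightarrow> real^'k) \<Rightarrow> (nat \<Rightarrow> 's \<Rightarrow> real^'k) \<Rightarrow>
   (nat \<Rightarrow> real^'k) \<Rightarrow> (nat \<Rightarrow> 's \<Rightarrow> real^'k) \<Rightarrow> real" where
  "lagrangian At A wt w f g j h N y0 u p \<zeta> ys Y =
     j (ys N) - p 0 \<bullet> (ys 0 - y0) +
     (\<Sum>n<N.
        p (Suc n) \<bullet> (- ys (Suc n) + ys n + h *\<^sub>R (\<Sum>i\<in>UNIV. wt$i *\<^sub>R f (Y n i, u n i))
                                          + h *\<^sub>R (\<Sum>i\<in>UNIV. w$i *\<^sub>R g (Y n i, u n i))) +
        (\<Sum>i\<in>UNIV. \<zeta> n i \<bullet> (- Y n i + ys n + h *\<^sub>R (\<Sum>j\<in>UNIV. At$i$j *\<^sub>R f (Y n j, u n j))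
                                              + h *\<^sub>R (\<Sum>j\<in>UNIV. A$i$j *\<^sub>R g (Y n j, u n j)))))"

text \<open>
  Stationarity of \<open>L\<close> in the variables \<open>ys 0, \<dots>, ys N\<close> and \<open>Y n i\<close> (\<open>n < N\<close>): each of the partial
  gradients exists and vanishes.
\<close>

definition stationary_at ::
  "nat \<Rightarrow> ((nat \<Rightarrow> real^'k) \<Rightarrow> (nat \<Rightarrow> 's::finite \<Rightarrow> real^'k) \<Rightarrow> real) \<Rightarrow>
   (nat \<Rightarrow> real^'k) \<Rightarrow> (nat \<Rightarrow> 's \<Rightarrow> real^'k) \<Rightarrow> bool" where
  "stationary_at N L ys Y \<longleftrightarrow>
     (\<forall>n\<le>N. GDERIV (\<lambda>z. L (ys(n := z)) Y) (ys n) :> 0) \<and>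
     (\<forall>n<N. \<forall>i. GDERIV (\<lambda>z. L ys (Y(n := (Y n)(i := z)))) (Y n i) :> 0)"


section \<open>Additive Runge--Kutta methods\<close>

text \<open>
  One step \<open>x \<mapsto> x'\<close>, with stage values \<open>X i\<close>, of an additive Runge--Kutta method for a system
  $\dot x_c = F_c(x,u) + G_c(x,u)$ with vector-valued components indexed by \<open>c\<close>. Every component
  has its own coefficient matrix \<open>aF c\<close> for the $F$-term and \<open>aG c\<close> for the $G$-term.
\<close>

definition additive_rk_step ::
  "('c \<Rightarrow> real^'s^'s) \<Rightarrow> ('c \<Rightarrow> real^'s^'s) \<Rightarrow> real^'s \<Rightarrow> real^'s \<Rightarrow>
   (('c \<Rightarrow> real^'k) \<times> (real^'m) \<Rightarrow> 'c \<Rightarrow> real^'k) \<Rightarrow> (('c \<Rightarrow> real^'k) \<times> (real^'m) \<Rightarrow> 'c \<Rightarrow> real^'k) \<Rightarrow>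
   real \<Rightarrow> ('s::finite \<Rightarrow> real^'m) \<Rightarrow> ('c \<Rightarrow> real^'k) \<Rightarrow> ('s \<Rightarrow> 'c \<Rightarrow> real^'k) \<Rightarrow> ('c \<Rightarrow> real^'k) \<Rightarrow> bool" where
  "additive_rk_step aF aG wF wG F G h u x X x' \<longleftrightarrow>
     (\<forall>i c. X i c = x c + h *\<^sub>R (\<Sum>j\<in>UNIV. aF c $i$j *\<^sub>R F (X j, u j) c)
                        + h *\<^sub>R (\<Sum>j\<in>UNIV. aG c $i$j *\<^sub>R G (X j, u j) c)) \<and>
     (\<forall>c. x' c = x c + h *\<^sub>R (\<Sum>i\<in>UNIV. wF$i *\<^sub>R F (X i, u i) c)
                     + h *\<^sub>R (\<Sum>i\<in>UNIV. wG$i *\<^sub>R G (X i, u i) c))"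

text \<open>The components of the extended system: $y$, $\tilde p$ and $p$.\<close>

datatype component = State | AdjointT | Adjoint

definition triple :: "'v \<Rightarrow> 'v \<Rightarrow> 'v \<Rightarrow> component \<Rightarrow> 'v" where
  "triple y pt p c = (case c of State \<Rightarrow> y | AdjointT \<Rightarrow> pt | Adjoint \<Rightarrow> p)"

definition ext_F ::
  "((real^'k) \<times> (real^'m) \<Rightarrow> real^'k) \<Rightarrow> (component \<Rightarrow> real^'k) \<times> (real^'m) \<Rightarrow> component \<Rightarrow> real^'k" where
  "ext_F f = (\<lambda>(x, u). triple
     (f (x State, u))
     (- (transpose (jac_y f (x State, u)) *v x AdjointT))
     (- (transpose (jac_y f (x State, u)) *v x AdjointT)))"

definition ext_G ::
  "((real^'k) \<times> (real^'m) \<Rightarrow> real^'k) \<Rightarrow> (component \<Rightarrow> real^'k) \<times> (real^'m) \<Rightarrow> component \<Rightarrow> real^'k" where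
  "ext_G g = (\<lambda>(x, u). triple
     (g (x State, u))
     (- (transpose (jac_y g (x State, u)) *v x Adjoint))
     (- (transpose (jac_y g (x State, u)) *v x Adjoint)))"

definition adjoint_update ::
  "real^'s \<Rightarrow> real^'s \<Rightarrow>
   ((real^'k) \<times> (real^'m) \<Rightarrow> real^'k) \<Rightarrow> ((real^'k) \<times> (real^'m) \<Rightarrow> real^'k) \<Rightarrow>
   real \<Rightarrow> nat \<Rightarrow> (nat \<Rightarrow> 's::finite \<Rightarrow> real^'m) \<Rightarrow> (nat \<Rightarrow> 's \<Rightarrow> real^'k) \<Rightarrow>
   (nat \<Rightarrow> real^'k) \<Rightarrow> (nat \<Rightarrow> 's \<Rightarrow> real^'k) \<Rightarrow> (nat \<Rightarrow> 's \<Rightarrow> real^'k) \<Rightarrow> bool" where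
  "adjoint_update wt w f g h N u Y pt Pt P \<longleftrightarrow>
     (\<forall>n<N. pt (Suc n) = pt n
           - h *\<^sub>R (\<Sum>i\<in>UNIV. wt$i *\<^sub>R (transpose (jac_y f (Y n i, u n i)) *v Pt n i))
           - h *\<^sub>R (\<Sum>i\<in>UNIV. w$i *\<^sub>R (transpose (jac_y g (Y n i, u n i)) *v P n i)))"

text \<open>
  \<open>state_eqs\<close> and \<open>adjoint_eqs\<close> are a Runge--Kutta discretization of the continuous state and
  adjoint equations if \<open>rk_equations\<close> and \<open>extended_equivalent\<close> below hold.

  \<open>rk_equations\<close>: the discrete equations together with the update for $\tilde p$ and
  $\tilde p_N = p_N$ imply $\tilde p_n = p_n$ for all $n$, and they are the equations of the
  additive Runge--Kutta method with coefficients \<open>aF\<close>, \<open>aG\<close> and weights \<open>wt\<close>, \<open>w\<close> for the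
  extended system. The coefficients are arguments, so that a statement can choose them independently
  of $f$, $g$ and the step size.
\<close>

definition rk_equations ::
  "(component \<Rightarrow> real^'s^'s) \<Rightarrow> (component \<Rightarrow> real^'s^'s) \<Rightarrow>
   real^'s^'s \<Rightarrow> real^'s^'s \<Rightarrow> real^'s \<Rightarrow> real^'s \<Rightarrow>
   ((real^'k) \<times> (real^'m) \<Rightarrow> real^'k) \<Rightarrow> ((real^'k) \<times> (real^'m) \<Rightarrow> real^'k) \<Rightarrow>
   real \<Rightarrow> nat \<Rightarrow> real^'k \<Rightarrow> bool" where
  "rk_equations aF aG At A wt w f g h N y0 \<longleftrightarrow>
     (\<forall>(u :: nat \<Rightarrow> 's::finite \<Rightarrow> real^'m) ys Y pt p Pt P.
        let SA = state_eqs At A wt w f g h N y0 u ys Y \<and>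
                 adjoint_eqs At A wt w f g h N u Y p Pt P \<and>
                 adjoint_update wt w f g h N u Y pt Pt P \<and> pt N = p N
        in
        (SA \<longrightarrow> (\<forall>n\<le>N. pt n = p n)) \<and>
        (SA \<longleftrightarrow>
           (\<forall>n<N. additive_rk_step aF aG wt w (ext_F f) (ext_G g) h (u n)
                    (triple (ys n) (pt n) (p n))
                    (\<lambda>i. triple (Y n i) (Pt n i) (P n i))
                    (triple (ys (Suc n)) (pt (Suc n)) (p (Suc n)))) \<and>
           ys 0 = y0 \<and> pt N = p N))"


section \<open>The continuous equations\<close>

definition solves_state_adjoint ::
  "((real^'k) \<times> (real^'m) \<Rightarrow> real^'k) \<Rightarrow> ((real^'k) \<times> (real^'m) \<Rightarrow> real^'k) \<Rightarrow>
   (real^'k \<Rightarrow> real) \<Rightarrow> real \<Rightarrow> real^'k \<Rightarrow> (real \<Rightarrow> real^'m) \<Rightarrow>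
   (real \<Rightarrow> real^'k) \<Rightarrow> (real \<Rightarrow> real^'k) \<Rightarrow> bool" where
  "solves_state_adjoint f g j T y0 u y p \<longleftrightarrow>
     (\<forall>t\<in>{0..T}.
        (y has_vector_derivative f (y t, u t) + g (y t, u t)) (at t within {0..T}) \<and>
        (p has_vector_derivative
            - (transpose (jac_y f (y t, u t)) *v p t) - transpose (jac_y g (y t, u t)) *v p t)
          (at t within {0..T})) \<and>
     y 0 = y0 \<and> p T = gradient j (y T)"

definition solves_extended ::
  "((real^'k) \<times> (real^'m) \<Rightarrow> real^'k) \<Rightarrow> ((real^'k) \<times> (real^'m) \<Rightarrow> real^'k) \<Rightarrow>
   (real^'k \<Rightarrow> real) \<Rightarrow> real \<Rightarrow> real^'k \<Rightarrow> (real \<Rightarrow> real^'m) \<Rightarrow>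
   (real \<Rightarrow> real^'k) \<Rightarrow> (real \<Rightarrow> real^'k) \<Rightarrow> (real \<Rightarrow> real^'k) \<Rightarrow> bool" where
  "solves_extended f g j T y0 u y pt p \<longleftrightarrow>
     (\<forall>t\<in>{0..T}. \<forall>c.
        ((\<lambda>\<tau>. triple (y \<tau>) (pt \<tau>) (p \<tau>) c) has_vector_derivative
            ext_F f (triple (y t) (pt t) (p t), u t) c + ext_G g (triple (y t) (pt t) (p t), u t) c)
          (at t within {0..T})) \<and>
     y 0 = y0 \<and> pt T = gradient j (y T) \<and> p T = gradient j (y T)"

definition extended_equivalent ::
  "((real^'k) \<times> (real^'m) \<Rightarrow> real^'k) \<Rightarrow> ((real^'k) \<times> (real^'m) \<Rightarrow> real^'k) \<Rightarrow>
   (real^'k \<Rightarrow> real) \<Rightarrow> real \<Rightarrow> real^'k \<Rightarrow> bool" where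
  "extended_equivalent f g j T y0 \<longleftrightarrow>
     (\<forall>u y pt p. solves_extended f g j T y0 u y pt p \<longleftrightarrow>
        (\<forall>t\<in>{0..T}. pt t = p t) \<and> solves_state_adjoint f g j T y0 u y p)"

definition rk_discretization ::
  "(component \<Rightarrow> real^'s^'s) \<Rightarrow> (component \<Rightarrow> real^'s^'s) \<Rightarrow>
   real^'s^'s \<Rightarrow> real^'s^'s \<Rightarrow> real^'s \<Rightarrow> real^('s::finite) \<Rightarrow>
   ((real^'k) \<times> (real^'m) \<Rightarrow> real^'k) \<Rightarrow> ((real^'k) \<times> (real^'m) \<Rightarrow> real^'k) \<Rightarrow>
   (real^'k \<Rightarrow> real) \<Rightarrow> real \<Rightarrow> nat \<Rightarrow> real^'k \<Rightarrow> bool" where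
  "rk_discretization aF aG At A wt w f g j T N y0 \<longleftrightarrow>
     rk_equations aF aG At A wt w f g (T / real N) N y0 \<and> extended_equivalent f g j T y0"

end

theory Submission
  imports Defs
begin

text \<open>
  Summation by parts in the Lagrangian separates the variables: up to a constant it is
  $j(y_N) - p_N^T y_N$ plus a linear function of each $y_n$ and a function of each stage value.
  The stationarity conditions are therefore $p_N = j'(y_N)$, $p_n = p_{n+1} + \sum_i \zeta_n^{(i)}$ and
  $\zeta_n^{(j)} = h \tilde\omega_j f_y^T \tilde P_n^{(j)} + h \omega_j g_y^T P_n^{(j)}$ with
  $\tilde\omega_j \tilde P_n^{(j)} = \tilde\omega_j p_{n+1} + \sum_i \tilde a_{ij} \zeta_n^{(i)}$ and
  $\omega_j P_n^{(j)} = \omega_j p_{n+1} + \sum_i a_{ij} \zeta_n^{(i)}$; dividing by the weights and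
  replacing $p_{n+1}$ by $p_n - \sum_i \zeta_n^{(i)}$ gives the adjoint equations.
  In the extended system $\tilde p$ and $p$ have the same right-hand side and the same final value,
  so they agree, both along the discrete and along the continuous trajectories.
\<close>

section \<open>Gradients\<close>

lemma C1_differentiable: "C1 F \<Longrightarrow> F differentiable (at x)"
  unfolding C1_def differentiable_def by blast

lemma GDERIV_unique:
  assumes "GDERIV f x :> D" and "GDERIV f x :> E"
  shows "D = E"
proof -
  have "(\<lambda>v. v \<bullet> D) = (\<lambda>v. v \<bullet> E)"
    using assms unfolding gderiv_def by (rule has_derivative_unique)
  then show ?thesis
    by (metis vector_eq_ldot)
qed

lemma GDERIV_cong: "GDERIV f x :> D \<Longrightarrow> D = E \<Longrightarrow> (\<And>z. f z = g z) \<Longrightarrow> GDERIV g x :> E"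
  by (metis ext)

lemma GDERIV_zero_iff: "GDERIV f x :> D \<Longrightarrow> GDERIV f x :> 0 \<longleftrightarrow> D = 0"
  using GDERIV_unique by blast

text \<open>Riesz representation: on a Euclidean space the derivative \<open>j'\<close> is the inner
  product with \<open>adjoint j' 1\<close>. Together with uniqueness this gives the definite
  description in \<open>gradient\<close> its value.\<close>

lemma GDERIV_gradient:
  fixes j :: "'a::euclidean_space \<Rightarrow> real"
  assumes "j differentiable (at y)"
  shows "GDERIV j y :> gradient j y"
proof -
  obtain j' where j': "(j has_derivative j') (at y)"
    using assms unfolding differentiable_def by blast
  have "j' = (\<lambda>v. v \<bullet> adjoint j' 1)"
    using adjoint_works[of j' _ 1] has_derivative_linear[OF j'] by (simp add: fun_eq_iff)
  then have "GDERIV j y :> adjoint j' 1"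
    using j' unfolding gderiv_def by simp
  then show ?thesis
    unfolding gradient_def by (rule theI) (rule GDERIV_unique[OF _ \<open>GDERIV j y :> adjoint j' 1\<close>])
qed

lemma GDERIV_inner_const: "GDERIV (\<lambda>z. c \<bullet> z) x :> c"
  unfolding gderiv_def by (auto intro!: derivative_eq_intros simp: inner_commute)

text \<open>Freezing \<open>u\<close> amounts to composing with the affine map
  \<open>z \<mapsto> (z, u)\<close>, so the chain rule gives differentiability in \<open>z\<close>;
  moving the Jacobian across the inner product produces the transpose.\<close>

lemma GDERIV_inner_jac_y:
  fixes f :: "(real^'k) \<times> (real^'m) \<Rightarrow> real^'k"
  assumes "C1 f"
  shows "GDERIV (\<lambda>z. q \<bullet> f (z, u)) y :> transpose (jac_y f (y, u)) *v q"
proof -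
  have "(\<lambda>z. f (z, u)) differentiable (at y)"
    by (rule differentiable_chain_at[where g = f and f = "\<lambda>z. (z, u)", unfolded o_def])
       (auto intro: C1_differentiable[OF assms] derivative_intros)
  then have "((\<lambda>z. f (z, u)) has_derivative (\<lambda>v. jac_y f (y, u) *v v)) (at y)"
    unfolding jac_y_def using jacobian_works by auto
  then have "((\<lambda>z. q \<bullet> f (z, u)) has_derivative (\<lambda>v. q \<bullet> (jac_y f (y, u) *v v))) (at y)"
    by (rule has_derivative_inner_right)
  then show ?thesis
    unfolding gderiv_def by (simp add: dot_lmul_matrix[symmetric] inner_commute)
qed


section \<open>Stationary points of the Lagrangian\<close>

text \<open>With \<open>q = p (Suc n)\<close>, this is the total factor in front of \<open>h\<close>
  times the right-hand side at stage \<open>j\<close> in one step of the Lagrangian: the update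
  contributes \<open>b$j\<close>, the stage equations contribute column \<open>j\<close> of
  \<open>B\<close>. At a stationary point it equals \<open>b$j\<close> times the adjoint stage
  value.\<close>

definition stage_multiplier ::
  "real^'s^'s \<Rightarrow> real^'s \<Rightarrow> 'v \<Rightarrow> ('s::finite \<Rightarrow> 'v) \<Rightarrow> 's \<Rightarrow> 'v::real_vector" where
  "stage_multiplier B b q \<zeta> j = b$j *\<^sub>R q + (\<Sum>i\<in>UNIV. B$i$j *\<^sub>R \<zeta> i)"

text \<open>The share of one step of the Lagrangian that depends on the value \<open>z\<close> of
  stage \<open>j\<close>.\<close>

definition stage_lagrangian ::
  "real^'s^'s \<Rightarrow> real^'s^'s \<Rightarrow> real^'s \<Rightarrow> real^'s \<Rightarrow>
   ((real^'k) \<times> (real^'m) \<Rightarrow> real^'k) \<Rightarrow> ((real^'k) \<times> (real^'m) \<Rightarrow> real^'k) \<Rightarrow>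
   real \<Rightarrow> ('s::finite \<Rightarrow> real^'m) \<Rightarrow> real^'k \<Rightarrow> ('s \<Rightarrow> real^'k) \<Rightarrow> 's \<Rightarrow> real^'k \<Rightarrow> real" where
  "stage_lagrangian At A wt w f g h u q \<zeta> j z =
     h * (stage_multiplier At wt q \<zeta> j \<bullet> f (z, u j)) +
     h * (stage_multiplier A w q \<zeta> j \<bullet> g (z, u j)) - \<zeta> j \<bullet> z"

text \<open>Interchanging the double sum groups the terms by the stage at which \<open>v\<close> is
  evaluated instead of by the equation in which it occurs.\<close>

lemma sum_stage_multiplier:
  fixes q :: "'v::real_inner"
  shows "(\<Sum>j\<in>UNIV. stage_multiplier B b q \<zeta> j \<bullet> v j) =
    q \<bullet> (\<Sum>i\<in>UNIV. b$i *\<^sub>R v i) + (\<Sum>i\<in>UNIV. \<zeta> i \<bullet> (\<Sum>j\<in>UNIV. B$i$j *\<^sub>R v j))"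
proof -
  have "(\<Sum>i\<in>UNIV. \<zeta> i \<bullet> (\<Sum>j\<in>UNIV. B$i$j *\<^sub>R v j)) =
      (\<Sum>j\<in>UNIV. \<Sum>i\<in>UNIV. B$i$j * (\<zeta> i \<bullet> v j))"
    unfolding inner_sum_right inner_scaleR_right by (rule sum.swap)
  then show ?thesis
    by (simp add: stage_multiplier_def inner_add_left inner_sum_left inner_sum_right sum.distrib)
qed

lemma lagrangian_split:
  "lagrangian At A wt w f g j h N y0 u p \<zeta> ys Y =
     j (ys N) - p N \<bullet> ys N + p 0 \<bullet> y0 +
     (\<Sum>n<N. (p (Suc n) + (\<Sum>i\<in>UNIV. \<zeta> n i) - p n) \<bullet> ys n) +
     (\<Sum>n<N. \<Sum>i\<in>UNIV. stage_lagrangian At A wt w f g h (u n) (p (Suc n)) (\<zeta> n) i (Y n i))"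
proof -
  \<comment> \<open>Adding and subtracting \<open>p n \<bullet> ys n\<close> creates a difference
    that telescopes to \<open>p 0 \<bullet> ys 0 - p N \<bullet> ys N\<close>; its first term
    cancels against the multiplier term of the initial condition.\<close>
  have step: "p (Suc n) \<bullet> (- ys (Suc n) + ys n + h *\<^sub>R (\<Sum>i\<in>UNIV. wt$i *\<^sub>R f (Y n i, u n i))
          + h *\<^sub>R (\<Sum>i\<in>UNIV. w$i *\<^sub>R g (Y n i, u n i))) +
        (\<Sum>i\<in>UNIV. \<zeta> n i \<bullet> (- Y n i + ys n + h *\<^sub>R (\<Sum>j\<in>UNIV. At$i$j *\<^sub>R f (Y n j, u n j))
                                + h *\<^sub>R (\<Sum>j\<in>UNIV. A$i$j *\<^sub>R g (Y n j, u n j)))) =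
     (p n \<bullet> ys n - p (Suc n) \<bullet> ys (Suc n)) + (p (Suc n) + (\<Sum>i\<in>UNIV. \<zeta> n i) - p n) \<bullet> ys n +
     (\<Sum>i\<in>UNIV. stage_lagrangian At A wt w f g h (u n) (p (Suc n)) (\<zeta> n) i (Y n i))" for n
    unfolding stage_lagrangian_def sum.distrib sum_subtractf sum_distrib_left[symmetric]
      sum_stage_multiplier
    by (simp add: inner_add_left inner_add_right inner_diff_left inner_sum_left sum.distrib
        sum_distrib_left sum_negf sum_subtractf algebra_simps)
  show ?thesis
    unfolding lagrangian_def step sum.distrib
    using sum_lessThan_telescope'[of "\<lambda>n. p n \<bullet> ys n" N] by (simp add: inner_diff_right)
qed

lemma stage_lagrangian_GDERIV:
  assumes "C1 f" and "C1 g"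
  shows "GDERIV (stage_lagrangian At A wt w f g h u q \<zeta> j) z :>
     h *\<^sub>R (transpose (jac_y f (z, u j)) *v stage_multiplier At wt q \<zeta> j) +
     h *\<^sub>R (transpose (jac_y g (z, u j)) *v stage_multiplier A w q \<zeta> j) - \<zeta> j"
proof -
  have "GDERIV (\<lambda>z. h * (stage_multiplier At wt q \<zeta> j \<bullet> f (z, u j))) z :>
      h *\<^sub>R (transpose (jac_y f (z, u j)) *v stage_multiplier At wt q \<zeta> j)"
    using GDERIV_mult[OF GDERIV_const[of h] GDERIV_inner_jac_y[OF \<open>C1 f\<close>]] by simp
  moreover have "GDERIV (\<lambda>z. h * (stage_multiplier A w q \<zeta> j \<bullet> g (z, u j))) z :>
      h *\<^sub>R (transpose (jac_y g (z, u j)) *v stage_multiplier A w q \<zeta> j)"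
    using GDERIV_mult[OF GDERIV_const[of h] GDERIV_inner_jac_y[OF \<open>C1 g\<close>]] by simp
  ultimately show ?thesis
    unfolding stage_lagrangian_def[abs_def] by (intro GDERIV_diff GDERIV_add GDERIV_inner_const)
qed

text \<open>Only the summand with \<open>k = i\<close> sees the update; all others join the constant
  \<open>c\<close>.\<close>

lemma GDERIV_sum_fun_upd:
  assumes "finite I" and "i \<in> I" and "GDERIV (F i) (x i) :> D"
  shows "GDERIV (\<lambda>z. c + (\<Sum>k\<in>I. F k ((x(i := z)) k))) (x i) :> D"
proof -
  have "(\<Sum>k\<in>I. F k ((x(i := z)) k)) = F i z + (\<Sum>k\<in>I - {i}. F k (x k))" for z
    using assms(1,2) by (simp add: sum.remove)
  then show ?thesis
    using GDERIV_add[OF GDERIV_const[of "c + (\<Sum>k\<in>I - {i}. F k (x k))"] assms(3)]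
    by (simp add: algebra_simps)
qed

lemma stationary_lagrangian_iff:
  assumes "C1 f" and "C1 g" and "C1 j"
  shows "stationary_at N (lagrangian At A wt w f g j h N y0 u p \<zeta>) ys Y \<longleftrightarrow>
     p N = gradient j (ys N) \<and>
     (\<forall>n<N. p n = p (Suc n) + (\<Sum>i\<in>UNIV. \<zeta> n i) \<and>
       (\<forall>i. \<zeta> n i =
          h *\<^sub>R (transpose (jac_y f (Y n i, u n i)) *v stage_multiplier At wt (p (Suc n)) (\<zeta> n) i) +
          h *\<^sub>R (transpose (jac_y g (Y n i, u n i)) *v stage_multiplier A w (p (Suc n)) (\<zeta> n) i)))"
proof -
  let ?L = "lagrangian At A wt w f g j h N y0 u p \<zeta>"
  let ?H = "\<lambda>n. stage_lagrangian At A wt w f g h (u n) (p (Suc n)) (\<zeta> n)"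
  let ?D = "\<lambda>n i.
      h *\<^sub>R (transpose (jac_y f (Y n i, u n i)) *v stage_multiplier At wt (p (Suc n)) (\<zeta> n) i) +
      h *\<^sub>R (transpose (jac_y g (Y n i, u n i)) *v stage_multiplier A w (p (Suc n)) (\<zeta> n) i)"
  \<comment> \<open>\<open>ys N\<close> occurs in none of the sums over \<open>n < N\<close>, so
    only \<open>j\<close> and the boundary term left by telescoping depend on it.\<close>
  have N: "GDERIV (\<lambda>z. ?L (ys(N := z)) Y) (ys N) :> gradient j (ys N) - p N"
  proof -
    have "GDERIV (\<lambda>z. j z - p N \<bullet> z +
        (p 0 \<bullet> y0 + (\<Sum>n<N. (p (Suc n) + (\<Sum>i\<in>UNIV. \<zeta> n i) - p n) \<bullet> ys n) +
         (\<Sum>n<N. \<Sum>i\<in>UNIV. ?H n i (Y n i)))) (ys N) :> gradient j (ys N) - p N + 0"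
      by (intro GDERIV_add GDERIV_diff GDERIV_const GDERIV_inner_const
          GDERIV_gradient C1_differentiable \<open>C1 j\<close>)
    then show ?thesis
      by (rule GDERIV_cong) (simp_all add: lagrangian_split)
  qed
  have n: "GDERIV (\<lambda>z. ?L (ys(n := z)) Y) (ys n) :> p (Suc n) + (\<Sum>i\<in>UNIV. \<zeta> n i) - p n"
    if "n < N" for n
  proof -
    have "GDERIV (\<lambda>z. (j (ys N) - p N \<bullet> ys N + p 0 \<bullet> y0 + (\<Sum>n<N. \<Sum>i\<in>UNIV. ?H n i (Y n i))) +
        (\<Sum>k<N. (p (Suc k) + (\<Sum>i\<in>UNIV. \<zeta> k i) - p k) \<bullet> (ys(n := z)) k)) (ys n) :>
        p (Suc n) + (\<Sum>i\<in>UNIV. \<zeta> n i) - p n"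
      using that
      by (intro GDERIV_sum_fun_upd[where F = "\<lambda>k v. (p (Suc k) + (\<Sum>i\<in>UNIV. \<zeta> k i) - p k) \<bullet> v"]
          GDERIV_inner_const) auto
    then show ?thesis
      by (rule GDERIV_cong) (use that in \<open>simp_all add: lagrangian_split\<close>)
  qed
  have Y: "GDERIV (\<lambda>z. ?L ys (Y(n := (Y n)(i := z)))) (Y n i) :> ?D n i - \<zeta> n i"
    if "n < N" for n i
  proof -
    \<comment> \<open>Collects everything free of the stages of step \<open>n\<close>. Step
      \<open>n\<close> itself stays a sum over stages, the shape that
      \<open>GDERIV_sum_fun_upd\<close> expects.\<close>
    let ?c = "j (ys N) - p N \<bullet> ys N + p 0 \<bullet> y0 +
        (\<Sum>n<N. (p (Suc n) + (\<Sum>i\<in>UNIV. \<zeta> n i) - p n) \<bullet> ys n) +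
        (\<Sum>k\<in>{..<N} - {n}. \<Sum>i\<in>UNIV. ?H k i (Y k i))"
    have "GDERIV (\<lambda>z. ?c + (\<Sum>l\<in>UNIV. ?H n l (((Y n)(i := z)) l))) (Y n i) :> ?D n i - \<zeta> n i"
      by (intro GDERIV_sum_fun_upd stage_lagrangian_GDERIV assms) auto
    moreover have "?L ys (Y(n := (Y n)(i := z))) = ?c + (\<Sum>l\<in>UNIV. ?H n l (((Y n)(i := z)) l))" for z
      using that by (simp add: lagrangian_split sum.remove[of "{..<N}" n])
    ultimately show ?thesis
      by presburger
  qed
  have N0: "GDERIV (\<lambda>z. ?L (ys(N := z)) Y) (ys N) :> 0 \<longleftrightarrow> p N = gradient j (ys N)"
    unfolding GDERIV_zero_iff[OF N] by auto
  have n0: "GDERIV (\<lambda>z. ?L (ys(n := z)) Y) (ys n) :> 0 \<longleftrightarrow> p n = p (Suc n) + (\<Sum>i\<in>UNIV. \<zeta> n i)"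
    if "n < N" for n
    unfolding GDERIV_zero_iff[OF n[OF that]] by auto
  have Y0: "GDERIV (\<lambda>z. ?L ys (Y(n := (Y n)(i := z)))) (Y n i) :> 0 \<longleftrightarrow> \<zeta> n i = ?D n i"
    if "n < N" for n i
    unfolding GDERIV_zero_iff[OF Y[OF that]] by auto
  have le: "(\<forall>n\<le>N. Q n) \<longleftrightarrow> Q N \<and> (\<forall>n<N. Q n)" for Q
    by (auto simp: le_less)
  show ?thesis
    unfolding stationary_at_def le using N0 n0 Y0 by blast
qed


section \<open>The discrete adjoint equations\<close>

text \<open>Both parts of the coefficient carry the factor \<open>v$j\<close>. Pulling it into
  \<open>(h * v$j) *\<^sub>R x j\<close> exposes the terms of which \<open>\<zeta> j\<close> is
  composed in \<open>adjoint_stage_eq\<close>.\<close>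

lemma adj_coef_sum:
  fixes x :: "'s::finite \<Rightarrow> 'v::real_vector"
  assumes "d$i \<noteq> 0"
  shows "h *\<^sub>R (\<Sum>j\<in>UNIV. adj_coef v d B $i$j *\<^sub>R x j) =
    (\<Sum>j\<in>UNIV. (h * v$j) *\<^sub>R x j) - (1 / d$i) *\<^sub>R (\<Sum>j\<in>UNIV. B$j$i *\<^sub>R (h * v$j) *\<^sub>R x j)"
proof -
  have "h *\<^sub>R adj_coef v d B $i$j *\<^sub>R x j =
      (h * v$j) *\<^sub>R x j - (1 / d$i) *\<^sub>R B$j$i *\<^sub>R (h * v$j) *\<^sub>R x j" for j
    by (simp add: adj_coef_def algebra_simps)
  then show ?thesis
    by (simp add: scaleR_sum_right sum_subtractf)
qed

text \<open>The parts \<open>v$j\<close> and \<open>v'$j\<close> of the coefficients sum to the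
  total of all \<open>\<zeta> j\<close>, which turns \<open>p\<close> into \<open>q\<close>; the
  remaining parts give column \<open>i\<close> of \<open>B\<close> applied to
  \<open>\<zeta>\<close>, divided by \<open>d$i\<close>. Multiplying by \<open>d$i\<close> is
  reversible. The case \<open>d = wt\<close>, \<open>B = At\<close> serves \<open>Pt\<close>, and
  \<open>d = w\<close>, \<open>B = A\<close> serves \<open>P\<close>.\<close>

lemma adjoint_stage_eq:
  fixes x x' :: "'s::finite \<Rightarrow> 'v::real_vector"
  assumes "d$i \<noteq> 0" and "p = q + (\<Sum>j\<in>UNIV. \<zeta> j)"
    and "\<And>j. \<zeta> j = (h * v$j) *\<^sub>R x j + (h * v'$j) *\<^sub>R x' j"
  shows "P = p - h *\<^sub>R (\<Sum>j\<in>UNIV. adj_coef v d B $i$j *\<^sub>R x j)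
               - h *\<^sub>R (\<Sum>j\<in>UNIV. adj_coef v' d B $i$j *\<^sub>R x' j) \<longleftrightarrow>
         d$i *\<^sub>R P = stage_multiplier B d q \<zeta> i"
proof -
  have "p - h *\<^sub>R (\<Sum>j\<in>UNIV. adj_coef v d B $i$j *\<^sub>R x j)
          - h *\<^sub>R (\<Sum>j\<in>UNIV. adj_coef v' d B $i$j *\<^sub>R x' j) =
        q + (1 / d$i) *\<^sub>R (\<Sum>j\<in>UNIV. B$j$i *\<^sub>R \<zeta> j)"
    unfolding adj_coef_sum[OF assms(1)] assms(2)
    unfolding assms(3) by (simp add: scaleR_add_right sum.distrib)
  moreover have "P = q + (1 / d$i) *\<^sub>R (\<Sum>j\<in>UNIV. B$j$i *\<^sub>R \<zeta> j) \<longleftrightarrow>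
      d$i *\<^sub>R P = d$i *\<^sub>R (q + (1 / d$i) *\<^sub>R (\<Sum>j\<in>UNIV. B$j$i *\<^sub>R \<zeta> j))"
    using assms(1) by simp
  ultimately show ?thesis
    using assms(1) by (simp add: stage_multiplier_def scaleR_add_right)
qed

text \<open>One time step, with \<open>q\<close> for \<open>p (Suc n)\<close> and \<open>Mf\<close>,
  \<open>Mg\<close> for the transposed Jacobians. Nonzero weights make the passage from \<zeta> to
  the adjoint stages a division.\<close>

lemma adjoint_step_iff:
  fixes At A :: "real^'s::finite^'s" and Mf Mg :: "'s \<Rightarrow> real^'k^'k"
  assumes "\<forall>i. wt$i \<noteq> 0" and "\<forall>i. w$i \<noteq> 0"
  shows "(\<exists>\<zeta>. p = q + (\<Sum>i\<in>UNIV. \<zeta> i) \<and>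
       (\<forall>i. \<zeta> i = h *\<^sub>R (Mf i *v stage_multiplier At wt q \<zeta> i) +
                 h *\<^sub>R (Mg i *v stage_multiplier A w q \<zeta> i))) \<longleftrightarrow>
    (\<exists>Pt P.
       (\<forall>i. Pt i = p - h *\<^sub>R (\<Sum>j\<in>UNIV. adj_coef wt wt At $i$j *\<^sub>R (Mf j *v Pt j))
                   - h *\<^sub>R (\<Sum>j\<in>UNIV. adj_coef w wt At $i$j *\<^sub>R (Mg j *v P j))) \<and>
       (\<forall>i. P i = p - h *\<^sub>R (\<Sum>j\<in>UNIV. adj_coef wt w A $i$j *\<^sub>R (Mf j *v Pt j))
                   - h *\<^sub>R (\<Sum>j\<in>UNIV. adj_coef w w A $i$j *\<^sub>R (Mg j *v P j))) \<and>
       q = p - h *\<^sub>R (\<Sum>i\<in>UNIV. wt$i *\<^sub>R (Mf i *v Pt i)) - h *\<^sub>R (\<Sum>i\<in>UNIV. w$i *\<^sub>R (Mg i *v P i)))"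
    (is "(\<exists>\<zeta>. ?Z \<zeta>) \<longleftrightarrow> (\<exists>Pt P. ?A Pt P)")
proof
  have update: "q = p - h *\<^sub>R (\<Sum>i\<in>UNIV. wt$i *\<^sub>R (Mf i *v Pt i))
        - h *\<^sub>R (\<Sum>i\<in>UNIV. w$i *\<^sub>R (Mg i *v P i)) \<longleftrightarrow> p = q + (\<Sum>i\<in>UNIV. \<zeta> i)"
    if "\<And>j. \<zeta> j = (h * wt$j) *\<^sub>R (Mf j *v Pt j) + (h * w$j) *\<^sub>R (Mg j *v P j)" for Pt P \<zeta>
    unfolding that by (auto simp: sum.distrib scaleR_sum_right algebra_simps)
  {
    assume "\<exists>\<zeta>. ?Z \<zeta>"
    then obtain \<zeta> where \<zeta>: "?Z \<zeta>" ..
    \<comment> \<open>The choice forced by \<open>adjoint_stage_eq\<close>: an adjoint stage is the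
      stage multiplier divided by its weight.\<close>
    define Pt where "Pt i = (1 / wt$i) *\<^sub>R stage_multiplier At wt q \<zeta> i" for i
    define P where "P i = (1 / w$i) *\<^sub>R stage_multiplier A w q \<zeta> i" for i
    have Pt: "wt$i *\<^sub>R Pt i = stage_multiplier At wt q \<zeta> i"
      and P: "w$i *\<^sub>R P i = stage_multiplier A w q \<zeta> i" for i
      using assms by (simp_all add: Pt_def P_def)
    have p: "p = q + (\<Sum>i\<in>UNIV. \<zeta> i)"
      using \<zeta> by blast
    have z: "\<zeta> i = (h * wt$i) *\<^sub>R (Mf i *v Pt i) + (h * w$i) *\<^sub>R (Mg i *v P i)" for i
      using \<zeta> by (metis Pt P scaleR_matrix_vector_assoc matrix_vector_mult_scaleR scaleR_scaleR)
    have "?A Pt P"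
      using Pt P p assms
      by (intro conjI allI adjoint_stage_eq[OF _ p z, THEN iffD2] update[OF z, THEN iffD2]) blast+
    then show "\<exists>Pt P. ?A Pt P"
      by blast
  next
    assume "\<exists>Pt P. ?A Pt P"
    then obtain Pt P where PtP: "?A Pt P"
      by blast
    \<comment> \<open>Read off from the stationarity condition in the stage value, with the stage
      multipliers replaced by weighted adjoint stages.\<close>
    define \<zeta> where "\<zeta> i = (h * wt$i) *\<^sub>R (Mf i *v Pt i) + (h * w$i) *\<^sub>R (Mg i *v P i)" for i
    have p: "p = q + (\<Sum>i\<in>UNIV. \<zeta> i)"
      using PtP update[OF \<zeta>_def] by blast
    have stage: "wt$i *\<^sub>R Pt i = stage_multiplier At wt q \<zeta> i"
      and stage': "w$i *\<^sub>R P i = stage_multiplier A w q \<zeta> i" for i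
      using PtP adjoint_stage_eq[OF _ p \<zeta>_def] assms by blast+
    have "\<zeta> i = h *\<^sub>R (Mf i *v stage_multiplier At wt q \<zeta> i) +
                 h *\<^sub>R (Mg i *v stage_multiplier A w q \<zeta> i)" for i
      by (simp add: \<zeta>_def[of i] stage[symmetric] stage'[symmetric] matrix_vector_mult_scaleR)
    with p show "\<exists>\<zeta>. ?Z \<zeta>"
      by blast
  }
qed

lemma stationary_iff_adjoint_eqs:
  fixes At A :: "real^'s::finite^'s"
  assumes "\<forall>i. wt$i \<noteq> 0" and "\<forall>i. w$i \<noteq> 0" and "C1 f" and "C1 g" and "C1 j"
  shows "(\<exists>\<zeta>. stationary_at N (lagrangian At A wt w f g j h N y0 u p \<zeta>) ys Y) \<longleftrightarrow>
    p N = gradient j (ys N) \<and> (\<exists>Pt P. adjoint_eqs At A wt w f g h N u Y p Pt P)"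
proof -
  \<comment> \<open>For given \<open>p\<close>, the conditions of step \<open>n\<close> involve only
    the multipliers or adjoint stages of that step, so witnesses can be chosen separately for each
    \<open>n\<close>.\<close>
  have ex_family: "(\<exists>z. \<forall>n<N. Q n (z n)) \<longleftrightarrow> (\<exists>x y. \<forall>n<N. R n (x n) (y n))"
    if "\<And>n. (\<exists>z. Q n z) \<longleftrightarrow> (\<exists>x y. R n x y)"
    for Q :: "nat \<Rightarrow> ('s \<Rightarrow> real^'k) \<Rightarrow> bool" and R :: "nat \<Rightarrow> ('s \<Rightarrow> real^'k) \<Rightarrow> ('s \<Rightarrow> real^'k) \<Rightarrow> bool"
    using that by metis
  show ?thesis
    unfolding stationary_lagrangian_iff[OF assms(3-5)] ex_simps adjoint_eqs_def
      ex_family[OF adjoint_step_iff[OF assms(1,2)]] ..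
qed


section \<open>The extended system\<close>

lemma all_component: "(\<forall>c. Q c) \<longleftrightarrow> Q State \<and> Q AdjointT \<and> Q Adjoint"
  by (metis component.exhaust)

lemma triple_simps [simp]:
  "triple y pt p State = y" "triple y pt p AdjointT = pt" "triple y pt p Adjoint = p"
  by (simp_all add: triple_def)

text \<open>Both recursions have the same increments, which depend on the stages but not on
  \<open>p\<close> or \<open>pt\<close>; equality therefore propagates backwards from
  \<open>N\<close>.\<close>

lemma adjoint_update_unique:
  assumes "adjoint_update wt w f g h N u Y p Pt P" and "adjoint_update wt w f g h N u Y pt Pt P"
    and "pt N = p N" and "n \<le> N"
  shows "pt n = p n"
  using \<open>n \<le> N\<close>
proof (induction rule: inc_induct)
  case base
  show ?case by (rule assms(3))
next
  case (step n)
  then show ?case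
    using assms(1,2) unfolding adjoint_update_def by (simp add: algebra_simps)
qed

text \<open>The method starts the stages \<open>Pt\<close> from \<open>pt n\<close>, whereas the
  adjoint equations start them from \<open>p n\<close>. The common updates and final value make the
  two agree.\<close>

lemma rk_equations_adj_coef:
  "rk_equations (triple At (adj_coef wt wt At) (adj_coef wt w A))
     (triple A (adj_coef w wt At) (adj_coef w w A)) At A wt w f g h N y0"
proof -
  let ?aF = "triple At (adj_coef wt wt At) (adj_coef wt w A)"
  let ?aG = "triple A (adj_coef w wt At) (adj_coef w w A)"
  let ?rk = "\<lambda>u ys Y pt p Pt P. \<forall>n<N. additive_rk_step ?aF ?aG wt w (ext_F f) (ext_G g) h (u n)
      (triple (ys n) (pt n) (p n)) (\<lambda>i. triple (Y n i) (Pt n i) (P n i))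
      (triple (ys (Suc n)) (pt (Suc n)) (p (Suc n)))"
  have update: "adjoint_update wt w f g h N u Y p Pt P"
    if "adjoint_eqs At A wt w f g h N u Y p Pt P" for u Y p Pt P
    using that unfolding adjoint_eqs_def adjoint_update_def by blast
  have rk: "?rk u ys Y pt p Pt P \<longleftrightarrow>
      (\<forall>n<N.
        (\<forall>i. Y n i = ys n + h *\<^sub>R (\<Sum>j\<in>UNIV. At$i$j *\<^sub>R f (Y n j, u n j))
                          + h *\<^sub>R (\<Sum>j\<in>UNIV. A$i$j *\<^sub>R g (Y n j, u n j))) \<and>
        ys (Suc n) = ys n + h *\<^sub>R (\<Sum>i\<in>UNIV. wt$i *\<^sub>R f (Y n i, u n i))
                          + h *\<^sub>R (\<Sum>i\<in>UNIV. w$i *\<^sub>R g (Y n i, u n i))) \<and>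
      (\<forall>n<N.
        (\<forall>i. Pt n i = pt n
           - h *\<^sub>R (\<Sum>j\<in>UNIV. adj_coef wt wt At $i$j *\<^sub>R (transpose (jac_y f (Y n j, u n j)) *v Pt n j))
           - h *\<^sub>R (\<Sum>j\<in>UNIV. adj_coef w wt At $i$j *\<^sub>R (transpose (jac_y g (Y n j, u n j)) *v P n j))) \<and>
        (\<forall>i. P n i = p n
           - h *\<^sub>R (\<Sum>j\<in>UNIV. adj_coef wt w A $i$j *\<^sub>R (transpose (jac_y f (Y n j, u n j)) *v Pt n j))
           - h *\<^sub>R (\<Sum>j\<in>UNIV. adj_coef w w A $i$j *\<^sub>R (transpose (jac_y g (Y n j, u n j)) *v P n j)))) \<and>
      adjoint_update wt w f g h N u Y pt Pt P \<and> adjoint_update wt w f g h N u Y p Pt P"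
    for u ys Y pt p Pt P
    unfolding additive_rk_step_def all_component adjoint_update_def
    by (simp add: ext_F_def ext_G_def sum_negf) blast
  have same: "\<forall>n\<le>N. pt n = p n"
    if "adjoint_update wt w f g h N u Y p Pt P" "adjoint_update wt w f g h N u Y pt Pt P" "pt N = p N"
    for u Y pt p Pt P
    using adjoint_update_unique[OF that] by blast
  have "state_eqs At A wt w f g h N y0 u ys Y \<and> adjoint_eqs At A wt w f g h N u Y p Pt P \<and>
        adjoint_update wt w f g h N u Y pt Pt P \<and> pt N = p N \<longleftrightarrow>
      ?rk u ys Y pt p Pt P \<and> ys 0 = y0 \<and> pt N = p N" for u ys Y pt p Pt P
  \<comment> \<open>Each side of the equivalence implies this condition, so if it fails both sides
    are false; if it holds, \<open>pt\<close> and \<open>p\<close> may be exchanged at every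
    step.\<close>
  proof (cases "adjoint_update wt w f g h N u Y p Pt P \<and>
      adjoint_update wt w f g h N u Y pt Pt P \<and> pt N = p N")
    case True
    then have "\<And>n. n < N \<Longrightarrow> pt n = p n"
      using same less_imp_le by blast
    with True show ?thesis
      unfolding rk state_eqs_def adjoint_eqs_def adjoint_update_def by auto
  next
    case False
    then show ?thesis
      using update rk by blast
  qed
  then show ?thesis
    unfolding rk_equations_def Let_def using same update by blast
qed

lemma extended_equivalent:
  assumes "T > 0"
  shows "extended_equivalent f g j T y0"
  unfolding extended_equivalent_def
proof (intro allI iffI)
  fix u y pt p
  assume ext: "solves_extended f g j T y0 u y pt p"
  \<comment> \<open>The components \<open>AdjointT\<close> and \<open>Adjoint\<close> have identical
    right-hand sides, so \<open>pt - p\<close> is constant on the interval and its value at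
    \<open>T\<close> is zero.\<close>
  have diff: "((\<lambda>\<tau>. pt \<tau> - p \<tau>) has_vector_derivative 0) (at t within {0..T})" if "t \<in> {0..T}" for t
    using ext that unfolding solves_extended_def all_component
    by (auto intro!: derivative_eq_intros simp: ext_F_def ext_G_def)
  obtain c where "\<And>t. t \<in> {0..T} \<Longrightarrow> pt t - p t = c"
    using has_vector_derivative_zero_constant[OF convex_real_interval(5) diff] by blast
  moreover have "pt T = p T"
    using ext unfolding solves_extended_def by simp
  ultimately have eq: "\<forall>t\<in>{0..T}. pt t = p t"
    using assms by (metis atLeastAtMost_iff eq_iff_diff_eq_0 less_imp_le order_refl)
  with ext show "(\<forall>t\<in>{0..T}. pt t = p t) \<and> solves_state_adjoint f g j T y0 u y p"
    unfolding solves_extended_def solves_state_adjoint_def all_component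
    by (simp add: ext_F_def ext_G_def)
next
  fix u y pt p
  assume sa: "(\<forall>t\<in>{0..T}. pt t = p t) \<and> solves_state_adjoint f g j T y0 u y p"
  \<comment> \<open>The functions agree only on \<open>{0..T}\<close>, which suffices because the
    derivative is taken within that interval.\<close>
  have "(pt has_vector_derivative D) (at t within {0..T})"
    if "t \<in> {0..T}" "(p has_vector_derivative D) (at t within {0..T})" for t D
    using has_vector_derivative_transform[OF that(1) _ that(2)] sa by metis
  with sa assms show "solves_extended f g j T y0 u y pt p"
    unfolding solves_extended_def solves_state_adjoint_def all_component
    by (simp add: ext_F_def ext_G_def)
qed

theorem theorem2p1:
  fixes At A :: "real^'s^'s" and wt w :: "real^'s"
  assumes "\<forall>i. wt$i \<noteq> 0" and "\<forall>i. w$i \<noteq> 0"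
  shows
    "(\<forall>(f :: (real^'k) \<times> (real^'m) \<Rightarrow> real^'k) (g :: (real^'k) \<times> (real^'m) \<Rightarrow> real^'k)
        (j :: real^'k \<Rightarrow> real) (T :: real) (N :: nat) (h :: real) y0
        (u :: nat \<Rightarrow> 's \<Rightarrow> real^'m) ys Y p.
        C1 f \<and> C1 g \<and> C1 j \<and> T > 0 \<and> N > 0 \<and> h = T / real N \<and>
        state_eqs At A wt w f g h N y0 u ys Y \<longrightarrow>
          ((\<exists>\<zeta>. stationary_at N (lagrangian At A wt w f g j h N y0 u p \<zeta>) ys Y) \<longleftrightarrow>
           p N = gradient j (ys N) \<and> (\<exists>Pt P. adjoint_eqs At A wt w f g h N u Y p Pt P)))
     \<and>
     (\<exists>aF aG.
        \<forall>(f :: (real^'k) \<times> (real^'m) \<Rightarrow> real^'k) (g :: (real^'k) \<times> (real^'m) \<Rightarrow> real^'k)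
         (j :: real^'k \<Rightarrow> real) (T :: real) (N :: nat) y0.
        C1 f \<and> C1 g \<and> C1 j \<and> T > 0 \<and> N > 0 \<longrightarrow>
          rk_discretization aF aG At A wt w f g j T N y0)"
proof (intro conjI exI allI impI)
  show "(\<exists>\<zeta>. stationary_at N (lagrangian At A wt w f g j h N y0 u p \<zeta>) ys Y) \<longleftrightarrow>
      p N = gradient j (ys N) \<and> (\<exists>Pt P. adjoint_eqs At A wt w f g h N u Y p Pt P)"
    if "C1 f \<and> C1 g \<and> C1 j \<and> T > 0 \<and> N > 0 \<and> h = T / real N \<and> state_eqs At A wt w f g h N y0 u ys Y"
    for f g :: "(real^'k) \<times> (real^'m) \<Rightarrow> real^'k" and j T N h y0 u ys Y p
    using that assms by (intro stationary_iff_adjoint_eqs) auto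
next
  \<comment> \<open>These witnesses are built from \<open>At\<close>, \<open>A\<close>,
    \<open>wt\<close> and \<open>w\<close> alone, so one choice serves all \<open>f\<close>,
    \<open>g\<close>, \<open>j\<close>, \<open>T\<close> and \<open>N\<close>.\<close>
  show "rk_discretization (triple At (adj_coef wt wt At) (adj_coef wt w A))
      (triple A (adj_coef w wt At) (adj_coef w w A)) At A wt w f g j T N y0"
    if "C1 f \<and> C1 g \<and> C1 j \<and> T > 0 \<and> N > 0"
    for f g :: "(real^'k) \<times> (real^'m) \<Rightarrow> real^'k" and j T N y0
    using that rk_equations_adj_coef extended_equivalent unfolding rk_discretization_def by blast
qed

end
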